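(* (1) Let $C_1:=\{h(x,x^2,1): x\in\mathbb{R},\ h\in\mathbb{R}\}\subset\mathbb{R}^3$ (parabolic cone). Then $\dim_F(C_1)=1$. (2) There is an open interval $I_2\ni 0$ such that, with $C_2:=\{h(x+x^3,x^2,1): x\in I_2,\ h\in\mathbb{R}\}\subset\mathbb{R}^3$ (perturbed parabolic cone), $\dim_F(C_2)=1$ (and the same holds for every smaller open interval containing $0$). (3) Let $D_1:=\{(x,x^2,h): x\in\mathbb{R},\ h\in\mathbb{R}\}\subset\mathbb{R}^3$ (parabolic cylinder). Then $\dim_F(D_1)=1$.
   Context: For a Borel set $A\subset\mathbb{R}^n$, $\mathcal{M}(A)$ denotes the set of nonzero finite (positive) Borel measures on $\mathbb{R}^n$ supported on $A$; $\widehat{\mu}(\xi)=\int e^{-2\pi i x\cdot\xi}\,d\mu(x)$; and $\dim_F(A)$ is the supremum of $s\in[0,n]$ such that some $\mu\in\mathcal{M}(A)$ satisfies $\sup_{\xi}|\xi|^{s/2}|\widehat{\mu}(\xi)|<\infty$. *)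

theory Defs
  imports "HOL-Analysis.Analysis"
begin

definition fourier_meas :: "'a::euclidean_space measure \<Rightarrow> 'a \<Rightarrow> complex" where
  "fourier_meas \<mu> \<xi> = (\<integral>x. cis (- 2 * pi * (x \<bullet> \<xi>)) \<partial>\<mu>)"

definition meas_on :: "'a::euclidean_space set \<Rightarrow> 'a measure set" where
  "meas_on A = {\<mu>. sets \<mu> = sets borel \<and> finite_measure \<mu> \<and> emeasure \<mu> UNIV \<noteq> 0
                   \<and> (AE x in \<mu>. x \<in> A)}"

definition fourier_dim :: "'a::euclidean_space set \<Rightarrow> real" where
  "fourier_dim A = Sup {s. 0 \<le> s \<and> s \<le> real DIM('a) \<and>
      (\<exists>\<mu>\<in>meas_on A. \<exists>C. \<forall>\<xi>. norm \<xi> powr (s / 2) * cmod (fourier_meas \<mu> \<xi>) \<le> C)}"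

definition parabolic_cone :: "(real^3) set" where
  "parabolic_cone = {h *\<^sub>R vector [x, x^2, 1] | x h. True}"

definition perturbed_cone :: "real set \<Rightarrow> (real^3) set" where
  "perturbed_cone I = {h *\<^sub>R vector [x + x^3, x^2, 1] | x h. x \<in> I}"

definition parabolic_cylinder :: "(real^3) set" where
  "parabolic_cylinder = {vector [x, x^2, h] | x h. True}"

end

theory Submission
  imports Defs
begin

text \<open>Upper bound: if \<open>\<mu>\<close> decays like \<open>|\<xi>| powr - s\<close>, then averaging the characters
  \<open>cis (- 2 \<pi> k v \<bullet> x)\<close>, \<open>k < N\<close>, and squaring shows that every slab of thickness \<open>1/N\<close> has mass
  \<open>O(N powr - s)\<close>. Each surface is an envelope of planes, and a bounded piece of it is covered by
  \<open>O(sqrt N)\<close> slabs of thickness \<open>1/N\<close> around its tangent planes, so it carries no mass if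
  \<open>s > 1/2\<close>.

  Lower bound: Lebesgue measure in the parameters \<open>(x, h)\<close> is pushed to the surface. If the third
  coordinate of \<open>\<xi>\<close> dominates, the integral in \<open>h\<close> is nonstationary; otherwise
  van der Corput's lemma applies to the integral in \<open>x\<close>.\<close>

section \<open>Mass of slabs and tangent planes\<close>

text \<open>Comparison with the integral of \<open>x powr - s\<close>: by the mean value theorem
  each new term is at most the increment of \<open>x powr (1 - s) / (1 - s)\<close>.\<close>

lemma sum_powr_le:
  fixes s :: real
  assumes "0 < s" "s < 1"
  shows "(\<Sum>k=1..N. real k powr - s) \<le> real N powr (1 - s) / (1 - s)"
proof (induction N)
  case 0
  then show ?case by simp
next
  case (Suc N)
  have step: "(1 - s) * real (Suc N) powr - s \<le> real (Suc N) powr (1 - s) - real N powr (1 - s)"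
  proof (cases "N = 0")
    \<comment> \<open>The mean value theorem would need a derivative at 0, so this increment is
      checked directly: it reads \<open>1 - s \<le> 1\<close>.\<close>
    case True
    then show ?thesis using assms by simp
  next
    case False
    have "\<exists>z. real N < z \<and> z < real (Suc N) \<and>
        real (Suc N) powr (1 - s) - real N powr (1 - s) = (real (Suc N) - real N) * ((1 - s) * z powr - s)"
    proof (rule MVT2)
      fix x assume "real N \<le> x" "x \<le> real (Suc N)"
      then have "x > 0" using False by linarith
      then show "((\<lambda>x. x powr (1 - s)) has_real_derivative (1 - s) * x powr - s) (at x)"
        by (auto intro!: derivative_eq_intros)
    qed simp
    then obtain z where z: "real N < z" "z < real (Suc N)"
      "real (Suc N) powr (1 - s) - real N powr (1 - s) = (1 - s) * z powr - s"
      by auto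
    have "real (Suc N) powr - s \<le> z powr - s"
      using z False assms by (intro powr_mono2') auto
    then show ?thesis using z assms by (simp add: mult_left_mono)
  qed
  have "(\<Sum>k=1..Suc N. real k powr - s) \<le> real N powr (1 - s) / (1 - s) + real (Suc N) powr - s"
    using Suc by simp
  also have "\<dots> \<le> real (Suc N) powr (1 - s) / (1 - s)"
    using step assms by (simp add: divide_simps) (simp add: algebra_simps)
  finally show ?case .
qed

text \<open>Among the \<open>k < N\<close>, distance 0 from \<open>j\<close> occurs once and every
  positive distance at most twice, once on each side. This bounds a row of a Toeplitz matrix
  uniformly in \<open>j\<close>.\<close>

lemma sum_abs_diff_le:
  fixes g :: "nat \<Rightarrow> real"
  assumes "j < N" "\<And>m. g m \<ge> 0"
  shows "(\<Sum>k<N. g (nat \<bar>int j - int k\<bar>)) \<le> g 0 + 2 * (\<Sum>m=1..N. g m)"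
proof -
  have "{..<N} = {..<j} \<union> {j} \<union> {j<..<N}" using assms by auto
  then have "(\<Sum>k<N. g (nat \<bar>int j - int k\<bar>)) = (\<Sum>k\<in>{..<j} \<union> {j} \<union> {j<..<N}. g (nat \<bar>int j - int k\<bar>))"
    by simp
  also have "\<dots> = (\<Sum>k<j. g (nat \<bar>int j - int k\<bar>)) + g 0 + (\<Sum>k\<in>{j<..<N}. g (nat \<bar>int j - int k\<bar>))"
    by (subst sum.union_disjoint; (subst sum.union_disjoint)?; auto)
  also have "(\<Sum>k<j. g (nat \<bar>int j - int k\<bar>)) = (\<Sum>m=1..j. g m)"
    by (rule sum.reindex_bij_witness[of _ "\<lambda>m. j - m" "\<lambda>k. j - k"]) (auto simp: nat_diff_distrib')
  also have "\<dots> \<le> (\<Sum>m=1..N. g m)"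
    using assms by (intro sum_mono2) auto
  also have "(\<Sum>k\<in>{j<..<N}. g (nat \<bar>int j - int k\<bar>)) = (\<Sum>m=1..<N - j. g m)"
    by (rule sum.reindex_bij_witness[of _ "\<lambda>m. j + m" "\<lambda>k. k - j"]) (auto intro!: arg_cong[where f = g])
  also have "\<dots> \<le> (\<Sum>m=1..N. g m)"
    using assms by (intro sum_mono2) auto
  finally show ?thesis by simp
qed

text \<open>Chebyshev's inequality for the exponential sum \<open>D\<close>. On the slab its
  \<open>N\<close> terms point in nearly the same direction, so \<open>|D| \<ge> N/2\<close>. The
  integral of \<open>|D|^2\<close> is a Toeplitz sum of values of the transform at integer multiples
  of \<open>v\<close>, and these decay like \<open>|j - k| powr - s\<close>, which makes the sum
  \<open>O(N powr (2 - s))\<close>.\<close>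

lemma slab_measure_le:
  fixes \<mu> :: "'a::euclidean_space measure"
  assumes fin: "finite_measure \<mu>" and sets: "sets \<mu> = sets borel"
    and s: "0 < s" "s < 1"
    and decay: "\<And>\<xi>. norm \<xi> \<ge> 1 \<Longrightarrow> cmod (fourier_meas \<mu> \<xi>) \<le> C * norm \<xi> powr - s"
    and N: "N \<ge> 1" and v: "norm v \<ge> 1"
  shows "measure \<mu> {x. \<bar>v \<bullet> x - a\<bar> \<le> 1 / (6 * real N)}
      \<le> 4 * (measure \<mu> UNIV + 2 * C / (1 - s)) * real N powr - s"
proof -
  interpret finite_measure \<mu> by fact
  have meas[measurable_cong]: "sets \<mu> = sets borel" by fact
  have sp: "space \<mu> = UNIV" using sets_eq_imp_space_eq[OF sets] by simp
  have C: "C \<ge> 0"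
  proof -
    have "0 \<le> C * norm v powr - s"
      using decay[OF v] norm_ge_zero order_trans by blast
    moreover have "norm v powr - s > 0" using v by auto
    ultimately show ?thesis by (auto simp: zero_le_mult_iff)
  qed
  define M where "M = measure \<mu> UNIV"
  define S where "S = {x. \<bar>v \<bullet> x - a\<bar> \<le> 1 / (6 * real N)}"
  have S[measurable]: "S \<in> sets borel"
    unfolding S_def by (intro borel_closed closed_Collect_le continuous_intros)
  \<comment> \<open>Centring the phase at \<open>a\<close> makes all terms close to 1 on the slab;
    it changes each integral only by a unimodular factor.\<close>
  define e where "e k x = cis (- 2 * pi * real_of_int k * (v \<bullet> x - a))" for k x
  define D where "D x = (\<Sum>k<N. e (int k) x)" for x
  have e_meas[measurable]: "e k \<in> borel_measurable borel" for k
    unfolding e_def by (intro borel_measurable_continuous_onI continuous_intros)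
  have e_int: "integrable \<mu> (e k)" for k
    by (rule integrable_const_bound[of _ 1]) (auto simp: e_def)
  have e_mult: "e (int j) x * cnj (e (int k) x) = e (int j - int k) x" for j k x
    by (simp add: e_def cis_cnj cis_mult algebra_simps)
  have D2: "complex_of_real ((cmod (D x))\<^sup>2) = (\<Sum>j<N. \<Sum>k<N. e (int j - int k) x)" for x
  proof -
    have "complex_of_real ((cmod (D x))\<^sup>2) = D x * cnj (D x)"
      by (rule complex_norm_square)
    also have "\<dots> = (\<Sum>j<N. \<Sum>k<N. e (int j - int k) x)"
      by (simp add: D_def sum_product e_mult)
    finally show ?thesis .
  qed
  have e_integral: "cmod (\<integral>x. e k x \<partial>\<mu>) = cmod (fourier_meas \<mu> (real_of_int k *\<^sub>R v))" for k
  proof -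
    have "e k x = cis (2 * pi * real_of_int k * a) * cis (- 2 * pi * (x \<bullet> (real_of_int k *\<^sub>R v)))" for x
      by (simp add: e_def cis_mult algebra_simps inner_commute)
    then have "(\<integral>x. e k x \<partial>\<mu>) = cis (2 * pi * real_of_int k * a) * fourier_meas \<mu> (real_of_int k *\<^sub>R v)"
      by (simp add: fourier_meas_def)
    then show ?thesis by (simp add: norm_mult)
  qed
  \<comment> \<open>The diagonal is treated apart: there the integral is the total mass, while
    \<open>0 powr - s\<close> is 0 and gives no bound.\<close>
  define g where "g m = (if m = 0 then M else C * real m powr - s)" for m :: nat
  have g_nonneg: "g m \<ge> 0" for m using C by (auto simp: g_def M_def)
  have e_bound: "cmod (\<integral>x. e k x \<partial>\<mu>) \<le> g (nat \<bar>k\<bar>)" for k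
  proof (cases "k = 0")
    case True
    then show ?thesis by (simp add: g_def e_def M_def sp)
  next
    case False
    then have k: "\<bar>real_of_int k\<bar> \<ge> 1" by linarith
    have k1: "\<bar>real_of_int k\<bar> * 1 \<le> \<bar>real_of_int k\<bar> * norm v" 
      using v by (intro mult_left_mono) auto
    have "cmod (fourier_meas \<mu> (real_of_int k *\<^sub>R v)) \<le> C * norm (real_of_int k *\<^sub>R v) powr - s"
      using k k1 by (intro decay) auto
    also have "\<dots> \<le> C * \<bar>real_of_int k\<bar> powr - s"
      using k k1 s C by (intro mult_left_mono powr_mono2') auto
    finally show ?thesis using False by (simp add: e_integral g_def)
  qed
  have D2_int: "integrable \<mu> (\<lambda>x. (cmod (D x))\<^sup>2)"
  proof -
    have "integrable \<mu> (\<lambda>x. complex_of_real ((cmod (D x))\<^sup>2))"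
      unfolding D2 by (intro Bochner_Integration.integrable_sum e_int)
    from integrable_Re[OF this] show ?thesis by (simp only: Re_complex_of_real)
  qed
  have row: "(\<Sum>k<N. g (nat \<bar>int j - int k\<bar>)) \<le> real N powr (1 - s) * (M + 2 * C / (1 - s))"
    if "j < N" for j
  proof -
    have "(\<Sum>k<N. g (nat \<bar>int j - int k\<bar>)) \<le> g 0 + 2 * (\<Sum>m=1..N. g m)"
      using that g_nonneg by (rule sum_abs_diff_le)
    also have "(\<Sum>m=1..N. g m) = C * (\<Sum>m=1..N. real m powr - s)"
      unfolding sum_distrib_left by (intro sum.cong) (auto simp: g_def)
    also have "\<dots> \<le> C * (real N powr (1 - s) / (1 - s))"
      using s C by (intro mult_left_mono sum_powr_le) auto
    \<comment> \<open>Since \<open>N \<ge> 1\<close>, the power is at least 1 and absorbs the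
      diagonal term.\<close>
    also have "g 0 \<le> M * real N powr (1 - s)"
      using N s mult_left_mono[of 1 "real N powr (1 - s)" M] ge_one_powr_ge_zero[of "real N" "1 - s"]
      by (simp add: g_def M_def)
    finally show ?thesis by (simp add: algebra_simps)
  qed
  have "(\<integral>x. (cmod (D x))\<^sup>2 \<partial>\<mu>) = cmod (\<integral>x. complex_of_real ((cmod (D x))\<^sup>2) \<partial>\<mu>)"
    by (simp only: integral_complex_of_real norm_of_real) simp
  also have "\<dots> = cmod (\<Sum>j<N. \<Sum>k<N. \<integral>x. e (int j - int k) x \<partial>\<mu>)"
    unfolding D2 by (simp add: Bochner_Integration.integral_sum Bochner_Integration.integrable_sum e_int)
  also have "\<dots> \<le> (\<Sum>j<N. \<Sum>k<N. g (nat \<bar>int j - int k\<bar>))"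
    by (intro order_trans[OF norm_sum] sum_mono e_bound)
  also have "\<dots> \<le> (\<Sum>j<N. real N powr (1 - s) * (M + 2 * C / (1 - s)))"
    by (intro sum_mono row) auto
  also have "\<dots> = real N * real N powr (1 - s) * (M + 2 * C / (1 - s))"
    by simp
  also have "real N * real N powr (1 - s) = (real N)\<^sup>2 * real N powr - s"
  proof -
    have "real N powr (1 - s) = real N powr 1 * real N powr - s"
      by (subst powr_add[symmetric]) simp
    then show ?thesis using N by (simp add: power2_eq_square)
  qed
  finally have upper: "(\<integral>x. (cmod (D x))\<^sup>2 \<partial>\<mu>) \<le> (real N)\<^sup>2 * real N powr - s * (M + 2 * C / (1 - s))" .
  have lower: "(real N)\<^sup>2 / 4 * indicator S x \<le> (cmod (D x))\<^sup>2" for x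
  proof (cases "x \<in> S")
    case True
    \<comment> \<open>The 6 in the thickness is chosen here: every phase is at most
      \<open>2 pi / 6 = pi / 3\<close> in absolute value, and
      \<open>cos (pi / 3) = 1/2\<close>.\<close>
    have "1/2 \<le> Re (e (int k) x)" if "k < N" for k
    proof -
      have "\<bar>- 2 * pi * real k * (v \<bullet> x - a)\<bar> = 2 * pi * (real k * \<bar>v \<bullet> x - a\<bar>)"
        by (simp add: abs_mult)
      also have "real k * \<bar>v \<bullet> x - a\<bar> \<le> real N * (1 / (6 * real N))"
        using True that by (intro mult_mono) (auto simp: S_def)
      also have "\<dots> = 1 / 6" using N by simp
      finally have le: "\<bar>- 2 * pi * real k * (v \<bullet> x - a)\<bar> \<le> pi / 3" by simp
      have "cos (pi / 3) \<le> cos \<bar>- 2 * pi * real k * (v \<bullet> x - a)\<bar>"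
        using le by (intro cos_monotone_0_pi_le) auto
      then show ?thesis by (simp only: cos_abs_real e_def cis.simps of_int_of_nat_eq cos_60)
    qed
    then have "(\<Sum>k<N. 1/2) \<le> (\<Sum>k<N. Re (e (int k) x))" by (intro sum_mono) auto
    also have "\<dots> = Re (D x)" by (simp add: D_def)
    also have "\<dots> \<le> cmod (D x)" by (rule complex_Re_le_cmod)
    finally have "(real N / 2)\<^sup>2 \<le> (cmod (D x))\<^sup>2" by (intro power_mono) auto
    then show ?thesis using True by (simp add: power_divide)
  qed auto
  have "(real N)\<^sup>2 / 4 * measure \<mu> S = (\<integral>x. (real N)\<^sup>2 / 4 * indicator S x \<partial>\<mu>)"
    by (simp add: sp)
  also have "\<dots> \<le> (\<integral>x. (cmod (D x))\<^sup>2 \<partial>\<mu>)"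
    by (intro integral_mono D2_int lower integrable_mult_right integrable_real_indicator)
       (auto simp: emeasure_finite less_top[symmetric])
  also note upper
  finally have "(real N)\<^sup>2 * (measure \<mu> S / 4) \<le> (real N)\<^sup>2 * (real N powr - s * (M + 2 * C / (1 - s)))"
    by (simp add: algebra_simps)
  then have "measure \<mu> S / 4 \<le> real N powr - s * (M + 2 * C / (1 - s))"
    by (rule mult_left_le_imp_le) (use N in auto)
  then show ?thesis unfolding S_def[symmetric] M_def[symmetric] by (simp add: algebra_simps)
qed

text \<open>The set \<open>B\<close> lies on an envelope of hyperplanes to which it is tangent to second order, so
  a slab of thickness \<open>1/N\<close> absorbs a parameter interval of length about \<open>1/sqrt N\<close>.\<close>

lemma tangent_family_null:
  fixes \<mu> :: "'a::euclidean_space measure"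
  assumes fin: "finite_measure \<mu>" and sets: "sets \<mu> = sets borel"
    and s: "1/2 < s" "s < 1"
    and decay: "\<And>\<xi>. norm \<xi> \<ge> 1 \<Longrightarrow> cmod (fourier_meas \<mu> \<xi>) \<le> C * norm \<xi> powr - s"
    and v: "\<And>t. norm (v t) \<ge> 1" and K: "K > 0" and r: "r > 0"
    and tangent: "\<And>p. p \<in> B \<Longrightarrow> \<exists>x\<in>{-r..r}. \<forall>t\<in>{-r..r}. \<bar>v t \<bullet> p - a t\<bar> \<le> K * (x - t)\<^sup>2"
  shows "\<exists>T\<in>null_sets \<mu>. B \<subseteq> T"
proof -
  interpret finite_measure \<mu> by fact
  have [measurable_cong]: "sets \<mu> = sets borel" by fact
  define C' where "C' = 4 * (measure \<mu> UNIV + 2 * C / (1 - s))"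
  define c where "c = 2 * r * sqrt (6 * K) + 3"
  define slab where "slab t N = {p. \<bar>v t \<bullet> p - a t\<bar> \<le> 1 / (6 * real N)}" for t and N :: nat
  have slab_meas: "slab t N \<in> sets \<mu>" for t N
    unfolding slab_def sets by (intro borel_closed closed_Collect_le continuous_intros)
  have slab_le: "measure \<mu> (slab t N) \<le> C' * real N powr - s" if "N \<ge> 1" for t N
    unfolding slab_def C'_def using s by (intro slab_measure_le fin sets decay v that) auto
  have cover: "\<exists>S\<in>sets \<mu>. B \<subseteq> S \<and> measure \<mu> S \<le> c * C' * real N powr (1/2 - s)" if N: "N \<ge> 1" for N :: nat
  proof -
    \<comment> \<open>\<open>J\<close> is of order \<open>sqrt N\<close> and large enough that the
      mesh \<open>\<eta> = 2 r / J\<close> satisfies \<open>K * \<eta>^2 \<le> 1 / (6 N)\<close>,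
      the half-thickness of the slabs.\<close>
    define J where "J = nat \<lceil>2 * r * sqrt (6 * K * real N)\<rceil> + 1"
    have pos: "2 * r * sqrt (6 * K * real N) > 0" using r K N by simp
    have J: "2 * r * sqrt (6 * K * real N) \<le> real J" "real J \<le> 2 * r * sqrt (6 * K * real N) + 2" "J > 0"
      unfolding J_def using pos by linarith+
    define \<eta> where "\<eta> = 2 * r / real J"
    have \<eta>: "\<eta> > 0" unfolding \<eta>_def using r J by auto
    have \<eta>2: "K * \<eta>\<^sup>2 \<le> 1 / (6 * real N)"
    proof -
      have "(2 * r * sqrt (6 * K * real N))\<^sup>2 \<le> (real J)\<^sup>2"
        using J(1) pos by (intro power_mono) auto
      then have "(2 * r)\<^sup>2 * (6 * K * real N) \<le> (real J)\<^sup>2"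
        using K by (simp add: power_mult_distrib)
      then show ?thesis using N J(3) by (simp add: \<eta>_def power_divide field_simps)
    qed
    define t where "t i = - r + real i * \<eta>" for i :: nat
    define S where "S = (\<Union>i\<in>{..J}. slab (t i) N)"
    have "B \<subseteq> S"
    proof
      fix p assume "p \<in> B"
      then obtain x where x: "x \<in> {-r..r}" "\<forall>t\<in>{-r..r}. \<bar>v t \<bullet> p - a t\<bar> \<le> K * (x - t)\<^sup>2"
        using tangent by blast
      \<comment> \<open>The tangency parameter \<open>x\<close> of \<open>p\<close> is rounded down
        to the grid, so the tangent plane at \<open>t i\<close> passes within
        \<open>K * \<eta>^2\<close> of \<open>p\<close> in the sense of
        \<open>v (t i)\<close>.\<close>
      define i where "i = nat \<lfloor>(x + r) / \<eta>\<rfloor>"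
      have q: "(x + r) / \<eta> \<ge> 0" using x \<eta> by auto
      then have i: "real i \<le> (x + r) / \<eta>" "(x + r) / \<eta> < real i + 1"
        unfolding i_def by linarith+
      have "(x + r) / \<eta> \<le> 2 * r / \<eta>" using x \<eta> by (intro divide_right_mono) auto
      also have "\<dots> = real J" using r J by (simp add: \<eta>_def)
      finally have "i \<le> J" using i by linarith
      have ti: "t i \<le> x" "x - t i \<le> \<eta>" using i \<eta> by (auto simp: t_def field_simps)
      have "t i \<in> {-r..r}" using ti x \<eta> by (auto simp: t_def)
      then have "\<bar>v (t i) \<bullet> p - a (t i)\<bar> \<le> K * (x - t i)\<^sup>2" using x by blast
      also have "\<dots> \<le> K * \<eta>\<^sup>2" using K ti by (intro mult_left_mono power_mono) auto
      also note \<eta>2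
      finally have "p \<in> slab (t i) N" by (simp add: slab_def)
      then show "p \<in> S" using \<open>i \<le> J\<close> by (auto simp: S_def)
    qed
    moreover have "S \<in> sets \<mu>" unfolding S_def by (intro sets.finite_UN slab_meas) auto
    moreover have "measure \<mu> S \<le> c * C' * real N powr (1/2 - s)"
    proof -
      have C'0: "0 \<le> C' * real N powr - s"
        using slab_le[OF N] measure_nonneg order_trans by blast
      have "measure \<mu> S \<le> (\<Sum>i\<le>J. measure \<mu> (slab (t i) N))"
        unfolding S_def using slab_meas by (intro finite_measure_subadditive_finite) auto
      also have "\<dots> \<le> (\<Sum>i\<le>J. C' * real N powr - s)"
        by (intro sum_mono slab_le N)
      also have "\<dots> = (real J + 1) * (C' * real N powr - s)" by simp
      \<comment> \<open>The number of slabs is \<open>O(sqrt N)\<close>; the additive constant 3 is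
        absorbed because \<open>sqrt N \<ge> 1\<close>.\<close>
      also have "\<dots> \<le> (c * sqrt (real N)) * (C' * real N powr - s)"
      proof (intro mult_right_mono C'0)
        have "real J + 1 \<le> 2 * r * sqrt (6 * K) * sqrt (real N) + 3 * 1"
          using J by (simp add: real_sqrt_mult)
        also have "\<dots> \<le> 2 * r * sqrt (6 * K) * sqrt (real N) + 3 * sqrt (real N)"
          using N by (intro add_left_mono mult_left_mono) auto
        finally show "real J + 1 \<le> c * sqrt (real N)" by (simp add: c_def algebra_simps)
      qed
      also have "\<dots> = c * C' * (real N powr (1/2) * real N powr - s)"
        using N by (simp add: powr_half_sqrt)
      also have "\<dots> = c * C' * real N powr (1/2 - s)"
        by (subst powr_add[symmetric]) simp
      finally show ?thesis .
    qed
    ultimately show ?thesis by blast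
  qed
  then obtain S where S: "\<And>N. N \<ge> 1 \<Longrightarrow> S N \<in> sets \<mu> \<and> B \<subseteq> S N \<and>
      measure \<mu> (S N) \<le> c * C' * real N powr (1/2 - s)"
    by metis
  \<comment> \<open>\<open>B\<close> is not assumed measurable, so a measurable superset is
    produced. \<open>T\<close> lies in the cover for every \<open>N\<close>, and the bound
    \<open>N powr (1/2 - s)\<close> tends to 0 as \<open>s > 1/2\<close>.\<close>
  define T where "T = (\<Inter>N\<in>{1..}. S N)"
  have T: "T \<in> sets \<mu>" unfolding T_def using S by (intro sets.countable_INT') auto
  have "measure \<mu> T \<le> c * C' * real N powr (1/2 - s)" if "N \<ge> 1" for N
  proof -
    have "measure \<mu> T \<le> measure \<mu> (S N)"
      using S that by (intro finite_measure_mono) (auto simp: T_def)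
    then show ?thesis using S[OF that] by linarith
  qed
  moreover have "(\<lambda>N. c * C' * real N powr (1/2 - s)) \<longlonglongrightarrow> c * C' * 0"
    using s by (intro tendsto_mult tendsto_const tendsto_neg_powr filterlim_real_sequentially) auto
  ultimately have "measure \<mu> T \<le> 0"
    by (intro tendsto_lowerbound[of "\<lambda>N. c * C' * real N powr (1/2 - s)"])
       (auto intro!: eventually_sequentiallyI[of 1])
  then have "T \<in> null_sets \<mu>"
    using T measure_nonneg[of \<mu> T] by (intro null_setsI) (auto simp: emeasure_eq_measure)
  moreover have "B \<subseteq> T" using S by (auto simp: T_def)
  ultimately show ?thesis by blast
qed

section \<open>Upper bounds for the decay exponent\<close>

text \<open>If \<open>s > 1\<close>, the transform decays faster than
  \<open>|\<xi>| powr - (1/2)\<close>, so each piece \<open>B m\<close> is null. Countably many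
  pieces cover \<open>A\<close>, which carries all of the nonzero measure: a contradiction.\<close>

lemma decay_exponent_le_1:
  fixes A :: "'a::euclidean_space set"
  assumes \<mu>: "\<mu> \<in> meas_on A"
    and decay: "\<And>\<xi>. norm \<xi> powr (s / 2) * cmod (fourier_meas \<mu> \<xi>) \<le> C"
    and v: "\<And>t. norm (v t) \<ge> 1"
    and cover: "A \<subseteq> (\<Union>m::nat. B m)"
    and K: "\<And>m. K m > 0" and r: "\<And>m. r m > 0"
    and tangent: "\<And>m p. p \<in> B m \<Longrightarrow>
      \<exists>x\<in>{- r m..r m}. \<forall>t\<in>{- r m..r m}. \<bar>v t \<bullet> p - a t\<bar> \<le> K m * (x - t)\<^sup>2"
  shows "s \<le> 1"
proof (rule ccontr)
  assume "\<not> s \<le> 1"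
  \<comment> \<open>The slab estimate requires an exponent strictly between 1/2 and 1. Capping at
    3/4 is harmless, since for \<open>norm \<xi> \<ge> 1\<close> faster decay implies slower
    decay.\<close>
  define q where "q = min (s / 2) (3 / 4)"
  have q: "1/2 < q" "q < 1" "q \<le> s / 2" using \<open>\<not> s \<le> 1\<close> by (auto simp: q_def)
  have fin: "finite_measure \<mu>" and sets: "sets \<mu> = sets borel"
    and nz: "emeasure \<mu> UNIV \<noteq> 0" and ae: "AE x in \<mu>. x \<in> A"
    using \<mu> by (auto simp: meas_on_def)
  have decay': "cmod (fourier_meas \<mu> \<xi>) \<le> C * norm \<xi> powr - q" if "norm \<xi> \<ge> 1" for \<xi>
  proof -
    have "norm \<xi> powr q * cmod (fourier_meas \<mu> \<xi>) \<le> norm \<xi> powr (s / 2) * cmod (fourier_meas \<mu> \<xi>)"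
      using that q by (intro mult_right_mono powr_mono) auto
    also note decay
    finally have "norm \<xi> powr q * cmod (fourier_meas \<mu> \<xi>) \<le> C" .
    moreover have "norm \<xi> powr q > 0" using that by auto
    ultimately show ?thesis by (simp add: powr_minus divide_inverse[symmetric] pos_le_divide_eq mult.commute)
  qed
  have "\<exists>T\<in>null_sets \<mu>. B m \<subseteq> T" for m
    using tangent_family_null[OF fin sets q(1,2) decay' v K r tangent] by blast
  then obtain T where T: "\<And>m. T m \<in> null_sets \<mu>" "\<And>m. B m \<subseteq> T m" by metis
  have "(\<Union>m. T m) \<in> null_sets \<mu>" using T by (intro null_sets_UN) auto
  then have "AE x in \<mu>. x \<notin> (\<Union>m. T m)" by (rule AE_not_in)
  with ae have "AE x in \<mu>. False"
    by eventually_elim (use cover T in blast)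
  then have "emeasure \<mu> (space \<mu>) = 0"
    by (simp add: trivial_limit_def[symmetric] ae_filter_eq_bot_iff)
  then show False using nz sets_eq_imp_space_eq[OF sets] by simp
qed

text \<open>With \<open>\<gamma>(t) = (t + c t^3, t^2, 1)\<close>, the chosen normal
  \<open>v t\<close> is the cross product of \<open>\<gamma>(t)\<close> and
  \<open>\<gamma>'(t)\<close>. It belongs to the plane tangent to the cone along the line through
  \<open>\<gamma>(t)\<close>; these planes contain the origin, hence the offset 0.\<close>

lemma cubic_cone_decay_exponent_le_1:
  assumes \<mu>: "\<mu> \<in> meas_on {h *\<^sub>R vector [x + c * x^3, x^2, 1] | x h. x \<in> I}"
    and decay: "\<And>\<xi>::real^3. norm \<xi> powr (s / 2) * cmod (fourier_meas \<mu> \<xi>) \<le> C"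
    and c: "0 \<le> c" "c \<le> 1"
  shows "s \<le> 1"
proof (rule decay_exponent_le_1[OF \<mu> decay,
    of "\<lambda>t. vector [- 2 * t, 1 + 3 * c * t^2, t^2 - c * t^4]"
       "\<lambda>m. {h *\<^sub>R vector [x + c * x^3, x^2, 1] | x h. \<bar>x\<bar> \<le> real m \<and> \<bar>h\<bar> \<le> real m}"
       "\<lambda>m. (real m + 1) * (1 + 3 * (real m + 1)^2)" "\<lambda>m. real m + 1" "\<lambda>t. 0"])
  fix t :: real
  have "\<bar>vector [- 2 * t, 1 + 3 * c * t^2, t^2 - c * t^4] $ (2::3)\<bar>
      \<le> norm (vector [- 2 * t, 1 + 3 * c * t^2, t^2 - c * t^4] :: real^3)"
    by (rule component_le_norm_cart)
  moreover have "1 + 3 * c * t^2 \<ge> 1" using c by simp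
  ultimately show "1 \<le> norm (vector [- 2 * t, 1 + 3 * c * t^2, t^2 - c * t^4] :: real^3)"
    by simp
next
  show "{h *\<^sub>R vector [x + c * x^3, x^2, 1] | x h. x \<in> I}
     \<subseteq> (\<Union>m::nat. {h *\<^sub>R vector [x + c * x^3, x^2, 1] :: real^3 | x h. \<bar>x\<bar> \<le> real m \<and> \<bar>h\<bar> \<le> real m})"
  proof clarify
    fix x h :: real
    obtain m :: nat where "max \<bar>x\<bar> \<bar>h\<bar> \<le> real m" using real_arch_simple by blast
    then show "h *\<^sub>R vector [x + c * x^3, x^2, 1]
      \<in> (\<Union>m::nat. {h *\<^sub>R vector [x + c * x^3, x^2, 1] :: real^3 | x h. \<bar>x\<bar> \<le> real m \<and> \<bar>h\<bar> \<le> real m})"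
      by auto
  qed
next
  fix m :: nat and p :: "real^3"
  assume "p \<in> {h *\<^sub>R vector [x + c * x^3, x^2, 1] | x h. \<bar>x\<bar> \<le> real m \<and> \<bar>h\<bar> \<le> real m}"
  then obtain x h where p: "p = h *\<^sub>R vector [x + c * x^3, x^2, 1]" "\<bar>x\<bar> \<le> real m" "\<bar>h\<bar> \<le> real m"
    by blast
  \<comment> \<open>The \<open>+ 1\<close> keeps the parameter interval nondegenerate when
    \<open>m = 0\<close>.\<close>
  let ?r = "real m + 1"
  have "\<bar>vector [- 2 * t, 1 + 3 * c * t^2, t^2 - c * t^4] \<bullet> p - 0\<bar> \<le> ?r * (1 + 3 * ?r^2) * (x - t)\<^sup>2"
    if t: "t \<in> {- ?r..?r}" for t
  proof -
    \<comment> \<open>Tangency appears as a double root at \<open>x = t\<close>; it remains to bound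
      the cofactor on the piece.\<close>
    have "vector [- 2 * t, 1 + 3 * c * t^2, t^2 - c * t^4] \<bullet> p
        = h * (1 - c * t^2 - 2 * (c * (t * x))) * (x - t)\<^sup>2"
      by (simp add: p inner_vec_def sum_3) (simp add: algebra_simps power2_eq_square power3_eq_cube power4_eq_xxxx)
    moreover have "\<bar>h * (1 - c * t^2 - 2 * (c * (t * x)))\<bar> \<le> ?r * (1 + 3 * ?r^2)"
      unfolding abs_mult
    proof (rule mult_mono)
      have "\<bar>t * x\<bar> \<le> ?r * ?r" unfolding abs_mult using t p by (intro mult_mono) auto
      then have "\<bar>c * (t * x)\<bar> \<le> 1 * (?r * ?r)" unfolding abs_mult[of c] using c by (intro mult_mono) auto
      moreover have "t^2 \<le> ?r^2" using t by (intro power2_le_iff_abs_le[THEN iffD2]) auto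
      then have "c * t^2 \<le> 1 * ?r^2" using c by (intro mult_mono) auto
      moreover have "0 \<le> c * t^2" using c by auto
      ultimately show "\<bar>1 - c * t^2 - 2 * (c * (t * x))\<bar> \<le> 1 + 3 * ?r^2"
        unfolding power2_eq_square by (smt (verit))
    qed (use p in auto)
    ultimately show ?thesis by (simp add: abs_mult mult_right_mono)
  qed
  then show "\<exists>x\<in>{- ?r..?r}. \<forall>t\<in>{- ?r..?r}.
      \<bar>vector [- 2 * t, 1 + 3 * c * t^2, t^2 - c * t^4] \<bullet> p - 0\<bar> \<le> ?r * (1 + 3 * ?r^2) * (x - t)\<^sup>2"
    using p by (intro bexI[of _ x]) auto
qed (simp_all add: add_pos_nonneg)

text \<open>The tangent planes \<open>y - 2 t x = - t^2\<close> are parallel to the third axis, and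
  on the cylinder \<open>y - 2 t x + t^2\<close> with \<open>y = x^2\<close> equals the square of
  the difference of parameters. Hence \<open>K = 1\<close>, and the pieces have to bound
  \<open>x\<close> but not \<open>h\<close>.\<close>

lemma parabolic_cylinder_decay_exponent_le_1:
  assumes \<mu>: "\<mu> \<in> meas_on parabolic_cylinder"
    and decay: "\<And>\<xi>. norm \<xi> powr (s / 2) * cmod (fourier_meas \<mu> \<xi>) \<le> C"
  shows "s \<le> 1"
proof (rule decay_exponent_le_1[OF \<mu> decay, of "\<lambda>t. vector [- 2 * t, 1, 0]"
       "\<lambda>m. {vector [x, x^2, h] | x h. \<bar>x\<bar> \<le> real m}" "\<lambda>m. 1" "\<lambda>m. real m + 1" "\<lambda>t. - (t^2)"])
  fix t :: real
  have "\<bar>vector [- 2 * t, 1, 0] $ (2::3)\<bar> \<le> norm (vector [- 2 * t, 1, 0] :: real^3)"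
    by (rule component_le_norm_cart)
  then show "1 \<le> norm (vector [- 2 * t, 1, 0] :: real^3)" by simp
next
  show "parabolic_cylinder \<subseteq> (\<Union>m::nat. {vector [x, x^2, h] | x h. \<bar>x\<bar> \<le> real m})"
    unfolding parabolic_cylinder_def
  proof clarify
    fix x h :: real
    obtain m :: nat where "\<bar>x\<bar> \<le> real m" using real_arch_simple by blast
    then show "vector [x, x^2, h] \<in> (\<Union>m::nat. {vector [x, x^2, h] :: real^3 | x h. \<bar>x\<bar> \<le> real m})"
      by auto
  qed
next
  fix m :: nat and p :: "real^3"
  assume "p \<in> {vector [x, x^2, h] | x h. \<bar>x\<bar> \<le> real m}"
  then obtain x h where p: "p = vector [x, x^2, h]" "\<bar>x\<bar> \<le> real m" by blast
  have "vector [- 2 * t, 1, 0] \<bullet> p - - (t^2) = (x - t)\<^sup>2" for t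
    by (simp add: p inner_vec_def sum_3) (simp add: algebra_simps power2_eq_square)
  then show "\<exists>x\<in>{- (real m + 1)..real m + 1}. \<forall>t\<in>{- (real m + 1)..real m + 1}.
      \<bar>vector [- 2 * t, 1, 0] \<bullet> p - - (t^2)\<bar> \<le> 1 * (x - t)\<^sup>2"
    using p by (intro bexI[of _ x]) auto
qed auto

section \<open>Van der Corput estimates and a measure with optimal decay\<close>

text \<open>Integration by parts with \<open>u = 1 / f'\<close>: \<open>cis f\<close> is the
  derivative of \<open>- \<i> u cis f\<close> plus \<open>\<i> u' cis f\<close>. The increment of
  \<open>g\<close> dominates the variation of \<open>u\<close>; different choices of
  \<open>g\<close> give the two first-derivative tests below.\<close>

lemma cis_integral_by_parts_le:
  fixes f u g :: "real \<Rightarrow> real"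
  assumes ab: "a \<le> b"
    and f: "\<And>x. (f has_real_derivative f' x) (at x)"
    and u: "\<And>x. x \<in> {a..b} \<Longrightarrow> (u has_real_derivative u' x) (at x)"
    and uf: "\<And>x. x \<in> {a..b} \<Longrightarrow> u x * f' x = 1"
    and g: "\<And>x. x \<in> {a..b} \<Longrightarrow> (g has_real_derivative g' x) (at x)"
    and u'g': "\<And>x. x \<in> {a..b} \<Longrightarrow> \<bar>u' x\<bar> \<le> g' x"
  shows "cmod (integral {a..b} (\<lambda>x. cis (f x))) \<le> \<bar>u a\<bar> + \<bar>u b\<bar> + (g b - g a)"
proof -
  define F where "F x = - \<i> * (u x *\<^sub>R cis (f x))" for x
  define G where "G x = \<i> * (u' x *\<^sub>R cis (f x))" for x
  let ?I = "integral {a..b} (\<lambda>x. cis (f x))"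
  have F': "(F has_vector_derivative cis (f x) - G x) (at x within {a..b})" if x: "x \<in> {a..b}" for x
  proof -
    have "(f has_derivative (\<lambda>t. t * f' x)) (at x within {a..b})"
      using f[of x] by (auto simp: has_field_derivative_def mult_commute_abs intro: has_derivative_at_withinI)
    then have "((\<lambda>x. cis (f x)) has_derivative (\<lambda>t. (t * f' x) *\<^sub>R (\<i> * cis (f x)))) (at x within {a..b})"
      by (rule has_derivative_cis)
    then have "((\<lambda>x. cis (f x)) has_vector_derivative f' x *\<^sub>R (\<i> * cis (f x))) (at x within {a..b})"
      by (simp add: has_vector_derivative_def)
    moreover have "(u has_real_derivative u' x) (at x within {a..b})"
      using u[OF x] by (rule has_field_derivative_at_within)
    ultimately have "((\<lambda>x. u x *\<^sub>R cis (f x)) has_vector_derivative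
        u x *\<^sub>R (f' x *\<^sub>R (\<i> * cis (f x))) + u' x *\<^sub>R cis (f x)) (at x within {a..b})"
      by (rule has_vector_derivative_scaleR[rotated])
    then have "(F has_vector_derivative - \<i> * (u x *\<^sub>R (f' x *\<^sub>R (\<i> * cis (f x))) + u' x *\<^sub>R cis (f x))) (at x within {a..b})"
      unfolding F_def by (rule has_vector_derivative_mult_right)
    moreover have "f' x * u x = 1" using uf[OF x] by (simp add: mult.commute)
    ultimately show ?thesis by (simp add: G_def algebra_simps)
  qed
  have cont: "continuous_on {a..b} (\<lambda>x. cis (f x))"
    using f by (intro continuous_intros DERIV_continuous_on) (auto intro: has_field_derivative_at_within)
  have I: "((\<lambda>x. cis (f x)) has_integral ?I) {a..b}"
    by (intro integrable_integral integrable_continuous_real cont)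
  have "((\<lambda>x. cis (f x) - (cis (f x) - G x)) has_integral ?I - (F b - F a)) {a..b}"
    by (intro has_integral_diff I fundamental_theorem_of_calculus ab F')
  then have G: "(G has_integral ?I - (F b - F a)) {a..b}" by simp
  have g: "(g' has_integral g b - g a) {a..b}"
    using g by (intro fundamental_theorem_of_calculus ab)
      (auto simp: has_real_derivative_iff_has_vector_derivative[symmetric] intro: has_field_derivative_at_within)
  have "norm (integral {a..b} G) \<le> integral {a..b} g'"
    using G g u'g' by (intro integral_norm_bound_integral) (auto simp: G_def norm_mult)
  then have "cmod (?I - (F b - F a)) \<le> g b - g a"
    using G g by (simp add: integral_unique)
  moreover have "cmod ?I \<le> cmod (?I - (F b - F a)) + (cmod (F b) + cmod (F a))"
    using norm_triangle_ineq[of "?I - (F b - F a)" "F b - F a"] norm_triangle_ineq4[of "F b" "F a"] by simp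
  moreover have "cmod (F x) = \<bar>u x\<bar>" for x by (simp add: F_def norm_mult)
  ultimately show ?thesis by simp
qed

lemma cis_integral_le_length:
  fixes f :: "real \<Rightarrow> real"
  assumes "a \<le> b" "continuous_on {a..b} f"
  shows "cmod (integral {a..b} (\<lambda>x. cis (f x))) \<le> b - a"
  using integral_bound[OF assms(1), of "\<lambda>x. cis (f x)" 1] assms(2) by (auto intro: continuous_intros)

text \<open>Here \<open>f'\<close> may fail to be monotone; the variation of \<open>1 / f'\<close>
  is controlled by a linear \<open>g\<close> of slope \<open>L / k^2\<close>.\<close>

lemma van_der_Corput_first:
  fixes f :: "real \<Rightarrow> real"
  assumes ab: "a \<le> b"
    and f: "\<And>x. (f has_real_derivative f' x) (at x)"
    and f': "\<And>x. (f' has_real_derivative f'' x) (at x)"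
    and k: "0 < k" "\<And>x. x \<in> {a..b} \<Longrightarrow> k \<le> \<bar>f' x\<bar>"
    and L: "\<And>x. x \<in> {a..b} \<Longrightarrow> \<bar>f'' x\<bar> \<le> L"
  shows "cmod (integral {a..b} (\<lambda>x. cis (f x))) \<le> 2 / k + L * (b - a) / k\<^sup>2"
proof -
  have nz: "f' x \<noteq> 0" if "x \<in> {a..b}" for x using k(2)[OF that] k(1) by auto
  have inv: "\<bar>1 / f' x\<bar> \<le> 1 / k" if "x \<in> {a..b}" for x
    using k(2)[OF that] k(1) by (simp add: frac_le)
  have "cmod (integral {a..b} (\<lambda>x. cis (f x))) \<le> \<bar>1 / f' a\<bar> + \<bar>1 / f' b\<bar> + (L / k\<^sup>2 * b - L / k\<^sup>2 * a)"
  proof (rule cis_integral_by_parts_le[OF ab f, of _ "\<lambda>x. - f'' x / (f' x)\<^sup>2" _ "\<lambda>x. L / k\<^sup>2"])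
    fix x assume x: "x \<in> {a..b}"
    show "((\<lambda>x. 1 / f' x) has_real_derivative - f'' x / (f' x)\<^sup>2) (at x)"
      using nz[OF x] by (auto intro!: derivative_eq_intros f' simp: power2_eq_square)
    have "k\<^sup>2 \<le> (f' x)\<^sup>2" using power_mono[OF k(2)[OF x], of 2] k(1) by simp
    then show "\<bar>- f'' x / (f' x)\<^sup>2\<bar> \<le> L / k\<^sup>2"
      using L[OF x] k(1) by (simp add: abs_divide frac_le)
    show "((\<lambda>x. L / k\<^sup>2 * x) has_real_derivative L / k\<^sup>2) (at x)"
      using DERIV_cmult[OF DERIV_ident, of "L / k\<^sup>2" x] by simp
    show "1 / f' x * f' x = 1" using nz[OF x] by simp
  qed
  also have "\<dots> \<le> 1 / k + 1 / k + (L / k\<^sup>2 * b - L / k\<^sup>2 * a)"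
    using inv[of a] inv[of b] ab by (intro add_mono) auto
  finally show ?thesis by (simp add: algebra_simps diff_divide_distrib)
qed

text \<open>For nondecreasing \<open>f'\<close> the choice \<open>g = - 1 / f'\<close> is exact: the
  terms at \<open>b\<close> cancel and \<open>2 / f' a\<close> remains, independently of the length
  of the interval.\<close>

lemma van_der_Corput_first_mono:
  fixes f :: "real \<Rightarrow> real"
  assumes ab: "a \<le> b"
    and f: "\<And>x. (f has_real_derivative f' x) (at x)"
    and f': "\<And>x. (f' has_real_derivative f'' x) (at x)"
    and k: "0 < k" "\<And>x. x \<in> {a..b} \<Longrightarrow> k \<le> f' x"
    and pos: "\<And>x. x \<in> {a..b} \<Longrightarrow> 0 \<le> f'' x"
  shows "cmod (integral {a..b} (\<lambda>x. cis (f x))) \<le> 2 / k"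
proof -
  have nz: "f' x > 0" if "x \<in> {a..b}" for x using k(2)[OF that] k(1) by auto
  have inv: "1 / f' a \<le> 1 / k" using k(2)[of a] k(1) ab by (simp add: frac_le)
  have "cmod (integral {a..b} (\<lambda>x. cis (f x))) \<le> \<bar>1 / f' a\<bar> + \<bar>1 / f' b\<bar> + (- (1 / f' b) - - (1 / f' a))"
  proof (rule cis_integral_by_parts_le[OF ab f, of _ "\<lambda>x. - f'' x / (f' x)\<^sup>2" _ "\<lambda>x. f'' x / (f' x)\<^sup>2"])
    fix x assume x: "x \<in> {a..b}"
    show "((\<lambda>x. 1 / f' x) has_real_derivative - f'' x / (f' x)\<^sup>2) (at x)"
      using nz[OF x] by (auto intro!: derivative_eq_intros f' simp: power2_eq_square)
    show "((\<lambda>x. - (1 / f' x)) has_real_derivative f'' x / (f' x)\<^sup>2) (at x)"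
      using nz[OF x] by (auto intro!: derivative_eq_intros f' simp: power2_eq_square)
    show "\<bar>- f'' x / (f' x)\<^sup>2\<bar> \<le> f'' x / (f' x)\<^sup>2" using pos[OF x] by simp
    show "1 / f' x * f' x = 1" using nz[OF x] by simp
  qed
  also have "\<dots> = 2 * (1 / f' a)" using nz[of a] nz[of b] ab by simp
  finally show ?thesis using inv by simp
qed

text \<open>Cut at distance \<open>1 / sqrt k\<close> from \<open>a\<close>. The short piece is
  bounded by its length; beyond it \<open>f' \<ge> sqrt k\<close>, so the first-derivative test
  gives \<open>2 / sqrt k\<close>.\<close>

lemma van_der_Corput_half:
  fixes f :: "real \<Rightarrow> real"
  assumes ab: "a \<le> b"
    and f: "\<And>x. (f has_real_derivative f' x) (at x)"
    and f': "\<And>x. (f' has_real_derivative f'' x) (at x)"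
    and k: "0 < k" "\<And>x. x \<in> {a..b} \<Longrightarrow> k * (x - a) \<le> f' x"
    and pos: "\<And>x. x \<in> {a..b} \<Longrightarrow> 0 \<le> f'' x"
  shows "cmod (integral {a..b} (\<lambda>x. cis (f x))) \<le> 3 / sqrt k"
proof -
  have cont: "continuous_on S f" for S
    using f by (intro DERIV_continuous_on) (auto intro: has_field_derivative_at_within)
  define c where "c = a + 1 / sqrt k"
  have c: "a \<le> c" "c - a = 1 / sqrt k" using k by (auto simp: c_def)
  show ?thesis
  proof (cases "c \<le> b")
    case True
    have kc: "k * (c - a) = sqrt k" using k(1) unfolding c(2) by (simp add: real_div_sqrt)
    have "cmod (integral {c..b} (\<lambda>x. cis (f x))) \<le> 2 / sqrt k"
    proof (rule van_der_Corput_first_mono[OF True f f'])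
      fix x assume x: "x \<in> {c..b}"
      have "sqrt k \<le> k * (x - a)" unfolding kc[symmetric] using x k(1) by (intro mult_left_mono) auto
      also have "\<dots> \<le> f' x" using x c by (intro k) auto
      finally show "sqrt k \<le> f' x" .
      show "0 \<le> f'' x" using x c by (intro pos) auto
    qed (use k in auto)
    moreover have "cmod (integral {a..c} (\<lambda>x. cis (f x))) \<le> 1 / sqrt k"
      using cis_integral_le_length[OF c(1) cont] c by simp
    moreover have "integral {a..b} (\<lambda>x. cis (f x)) = integral {a..c} (\<lambda>x. cis (f x)) + integral {c..b} (\<lambda>x. cis (f x))"
      using c True by (intro Henstock_Kurzweil_Integration.integral_combine[symmetric] integrable_continuous_real)
        (auto intro!: continuous_intros cont)
    ultimately show ?thesis
      using norm_triangle_ineq[of "integral {a..c} (\<lambda>x. cis (f x))" "integral {c..b} (\<lambda>x. cis (f x))"]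
      by (simp add: add_divide_distrib[symmetric])
  next
    case False
    then have "b - a \<le> 1 / sqrt k" using c by linarith
    also have "\<dots> \<le> 3 / sqrt k" using k by (intro divide_right_mono) auto
    finally show ?thesis using cis_integral_le_length[OF ab cont] by linarith
  qed
qed

text \<open>\<open>f'\<close> grows at rate at least \<open>k\<close>, so away from the point where
  it changes sign it is at least \<open>k\<close> times the distance in absolute value. The half
  estimate then applies on both sides.\<close>

lemma van_der_Corput_second_pos:
  fixes f :: "real \<Rightarrow> real"
  assumes ab: "a \<le> b"
    and f: "\<And>x. (f has_real_derivative f' x) (at x)"
    and f': "\<And>x. (f' has_real_derivative f'' x) (at x)"
    and k: "0 < k" "\<And>x. x \<in> {a..b} \<Longrightarrow> k \<le> f'' x"
  shows "cmod (integral {a..b} (\<lambda>x. cis (f x))) \<le> 6 / sqrt k"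
proof -
  have cont: "continuous_on S f" for S
    using f by (intro DERIV_continuous_on) (auto intro: has_field_derivative_at_within)
  have grow: "k * (y - x) \<le> f' y - f' x" if "a \<le> x" "x \<le> y" "y \<le> b" for x y
  proof -
    have "f' x - k * x \<le> f' y - k * y"
    proof (rule DERIV_nonneg_imp_nondecreasing[OF that(2)])
      fix z assume "x \<le> z" "z \<le> y"
      then show "\<exists>d. ((\<lambda>x. f' x - k * x) has_real_derivative d) (at z) \<and> 0 \<le> d"
        using that k(2)[of z] by (intro exI[of _ "f'' z - k"]) (auto intro!: derivative_eq_intros f')
    qed
    then show ?thesis by (simp add: algebra_simps)
  qed
  \<comment> \<open>If \<open>f'\<close> has no zero, the cut is an endpoint and one of the two
    pieces is degenerate.\<close>
  have "\<exists>c\<in>{a..b}. (c = b \<or> 0 \<le> f' c) \<and> (c = a \<or> f' c \<le> 0)"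
  proof (cases "0 \<le> f' a \<or> f' b \<le> 0")
    case True
    then show ?thesis using ab by auto
  next
    case False
    then have "\<exists>x\<ge>a. x \<le> b \<and> f' x = 0"
      using ab f' by (intro IVT) (auto intro: DERIV_isCont)
    then obtain x where "x \<in> {a..b}" "f' x = 0" by auto
    then show ?thesis by (intro bexI[of _ x]) auto
  qed
  then obtain c where "c \<in> {a..b}" "(c = b \<or> 0 \<le> f' c) \<and> (c = a \<or> f' c \<le> 0)"
    by (rule bexE)
  then have c: "a \<le> c" "c \<le> b" "c = b \<or> 0 \<le> f' c" "c = a \<or> f' c \<le> 0"
    by simp_all
  have right: "cmod (integral {c..b} (\<lambda>x. cis (f x))) \<le> 3 / sqrt k"
  proof (cases "c = b")
    case False
    show ?thesis
    proof (rule van_der_Corput_half[OF c(2) f f' k(1)])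
      fix x assume x: "x \<in> {c..b}"
      then show "k * (x - c) \<le> f' x" using grow[of c x] c False by auto
      show "0 \<le> f'' x" using k(1) k(2)[of x] x c by auto
    qed
  qed (use k in auto)
  have left: "cmod (integral {a..c} (\<lambda>x. cis (f x))) \<le> 3 / sqrt k"
  proof (cases "c = a")
    case False
    \<comment> \<open>Reflection turns the right endpoint \<open>c\<close> into a left one and
      preserves the sign of the second derivative.\<close>
    have "cmod (integral {-c..-a} (\<lambda>x. cis (f (- x)))) \<le> 3 / sqrt k"
    proof (rule van_der_Corput_half[of _ _ _ "\<lambda>x. - f' (- x)" "\<lambda>x. f'' (- x)"])
      fix x
      show "((\<lambda>x. f (- x)) has_real_derivative - f' (- x)) (at x)"
        using DERIV_chain2[OF f DERIV_minus[OF DERIV_ident]] by simp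
      show "((\<lambda>x. - f' (- x)) has_real_derivative f'' (- x)) (at x)"
        using DERIV_minus[OF DERIV_chain2[OF f' DERIV_minus[OF DERIV_ident]]] by simp
    next
      fix x assume x: "x \<in> {-c..-a}"
      then show "k * (x - - c) \<le> - f' (- x)" using grow[of "- x" c] c False by (auto simp: add.commute)
      show "0 \<le> f'' (- x)" using k(1) k(2)[of "- x"] x c by auto
    qed (use c k in auto)
    then show ?thesis
      using Henstock_Kurzweil_Integration.integral_reflect_real[of c a "\<lambda>x. cis (f x)"] by simp
  qed (use k in auto)
  have "integral {a..b} (\<lambda>x. cis (f x)) = integral {a..c} (\<lambda>x. cis (f x)) + integral {c..b} (\<lambda>x. cis (f x))"
    using c by (intro Henstock_Kurzweil_Integration.integral_combine[symmetric] integrable_continuous_real)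
      (auto intro!: continuous_intros cont)
  then show ?thesis
    using left right norm_triangle_ineq[of "integral {a..c} (\<lambda>x. cis (f x))" "integral {c..b} (\<lambda>x. cis (f x))"]
    by (simp add: add_divide_distrib[symmetric])
qed

lemma van_der_Corput_second:
  fixes f :: "real \<Rightarrow> real"
  assumes ab: "a \<le> b"
    and f: "\<And>x. (f has_real_derivative f' x) (at x)"
    and f': "\<And>x. (f' has_real_derivative f'' x) (at x)"
    and k: "0 < k" "(\<forall>x\<in>{a..b}. k \<le> f'' x) \<or> (\<forall>x\<in>{a..b}. f'' x \<le> - k)"
  shows "cmod (integral {a..b} (\<lambda>x. cis (f x))) \<le> 6 / sqrt k"
  using k(2)
proof
  assume "\<forall>x\<in>{a..b}. k \<le> f'' x"
  then show ?thesis using van_der_Corput_second_pos[OF ab f f' k(1)] by blast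
next
  assume *: "\<forall>x\<in>{a..b}. f'' x \<le> - k"
  have "cmod (integral {a..b} (\<lambda>x. cis (- f x))) \<le> 6 / sqrt k"
  proof (rule van_der_Corput_second_pos[OF ab DERIV_minus[OF f] DERIV_minus[OF f'] k(1)])
    show "k \<le> - f'' x" if "x \<in> {a..b}" for x using * that by force
  qed
  moreover have "integral {a..b} (\<lambda>x. cis (- f x)) = cnj (integral {a..b} (\<lambda>x. cis (f x)))"
    by (simp add: integral_cnj cis_cnj)
  ultimately show ?thesis by simp
qed

section \<open>Oscillatory integrals over the surfaces\<close>

lemma lborel_interval_integral:
  fixes f :: "real \<Rightarrow> complex"
  assumes "continuous_on {a..b} f"
  shows "(\<integral>x. f x \<partial>restrict_space lborel {a..b}) = integral {a..b} f"
  using set_borel_integral_eq_integral(2)[OF borel_integrable_atLeastAtMost'[OF assms]]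
  by (simp add: integral_restrict_space set_lebesgue_integral_def)

text \<open>Linear-combination form, on which \<open>continuous_intros\<close> can work.\<close>

lemma vector_3_eq:
  "vector [a, b, c] = a *\<^sub>R axis 1 1 + b *\<^sub>R axis 2 1 + c *\<^sub>R (axis 3 1 :: real^3)"
  by (simp add: vec_eq_iff forall_3 axis_def)

text \<open>One family contains all three surfaces: \<open>d = 1\<close> gives the cones over \<open>(x + c x^3, x^2)\<close>,
  and \<open>c = d = 0\<close> gives the cylinder.\<close>

definition surface_point :: "real \<Rightarrow> real \<Rightarrow> real \<Rightarrow> real \<Rightarrow> real^3" where
  "surface_point c d x h = vector [(d * h + (1 - d)) * (x + c * x^3), (d * h + (1 - d)) * x^2, h]"

text \<open>If \<open>\<xi>$1\<close> dominates, then for \<open>x \<le> 1/4\<close> the first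
  derivative of the phase is of size \<open>norm \<xi>\<close>. If \<open>\<xi>$2\<close> dominates,
  the second derivative is, with constant sign. The tests of first and second order apply
  respectively; in both cases \<open>norm \<xi>\<close> is at most three times the dominant
  component.\<close>

lemma surface_phase_integral_x:
  fixes \<xi> :: "real^3"
  assumes e: "0 < e" "e \<le> 1/4" and c: "0 \<le> c" "c \<le> 1" and d: "0 \<le> d" "d \<le> 1"
    and h: "1 \<le> h" "h \<le> 2" and \<xi>: "norm \<xi> \<ge> 1" and small: "\<bar>\<xi>$3\<bar> \<le> max \<bar>\<xi>$1\<bar> \<bar>\<xi>$2\<bar>"
  shows "cmod (integral {0..e} (\<lambda>x. cis (- 2 * pi * (surface_point c d x h \<bullet> \<xi>)))) \<le> 18 / sqrt (norm \<xi>)"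
proof -
  define w where "w = d * h + (1 - d)"
  have "d * (h - 1) \<le> 1 * 1" "0 \<le> d * (h - 1)" using d h by (intro mult_mono mult_nonneg_nonneg; simp)+
  then have w: "1 \<le> w" "w \<le> 2" by (auto simp: w_def algebra_simps)
  define R where "R = norm \<xi>"
  have R: "R \<le> \<bar>\<xi>$1\<bar> + \<bar>\<xi>$2\<bar> + \<bar>\<xi>$3\<bar>" "1 \<le> R" using norm_le_l1_cart[of \<xi>] \<xi> by (auto simp: R_def sum_3)
  define f where "f x = - 2 * pi * (w * ((x + c * x^3) * \<xi>$1 + x^2 * \<xi>$2) + h * \<xi>$3)" for x
  define f' where "f' x = - 2 * pi * w * ((1 + 3 * c * x^2) * \<xi>$1 + 2 * x * \<xi>$2)" for x
  define f'' where "f'' x = - 2 * pi * w * (6 * c * x * \<xi>$1 + 2 * \<xi>$2)" for x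
  have f: "(f has_real_derivative f' x) (at x)" for x
    unfolding f_def f'_def by (auto intro!: derivative_eq_intros simp: algebra_simps power2_eq_square)
  have f': "(f' has_real_derivative f'' x) (at x)" for x
    unfolding f'_def f''_def by (auto intro!: derivative_eq_intros simp: algebra_simps)
  have f_eq: "- 2 * pi * (surface_point c d x h \<bullet> \<xi>) = f x" for x
    by (simp add: f_def surface_point_def w_def inner_vec_def sum_3 algebra_simps)
  have pw: "3 \<le> pi * w" "pi * w \<le> 8"
    using mult_mono[of 3 pi 1 w] mult_mono[of pi 4 w 2] w pi_gt3 pi_less_4 by auto
  have cx: "0 \<le> c * x" "c * x \<le> 1/4" "0 \<le> c * x^2" if "x \<in> {0..e}" for x
    using mult_mono[of c 1 x "1/4"] that c e by auto
  have "cmod (integral {0..e} (\<lambda>x. cis (f x))) \<le> 18 / sqrt R"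
  proof (cases "\<bar>\<xi>$2\<bar> \<le> \<bar>\<xi>$1\<bar>")
    case True
    have R1: "R \<le> 3 * \<bar>\<xi>$1\<bar>" using R True small by simp
    have "cmod (integral {0..e} (\<lambda>x. cis (f x))) \<le> 2 / R + (64 * R) * (e - 0) / R\<^sup>2"
    proof (rule van_der_Corput_first[OF _ f f'])
      fix x assume x: "x \<in> {0..e}"
      have A: "\<bar>f' x\<bar> = 2 * (pi * w) * \<bar>(1 + 3 * c * x^2) * \<xi>$1 + 2 * x * \<xi>$2\<bar>"
        using w by (simp add: f'_def abs_mult)
      have "1 * \<bar>\<xi>$1\<bar> \<le> (1 + 3 * c * x^2) * \<bar>\<xi>$1\<bar>"
        using cx[OF x] by (intro mult_right_mono) auto
      moreover have "2 * x * \<bar>\<xi>$2\<bar> \<le> 1/2 * \<bar>\<xi>$1\<bar>"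
        using x e True by (intro mult_mono) auto
      moreover have "\<bar>(1 + 3 * c * x^2) * \<xi>$1\<bar> = (1 + 3 * c * x^2) * \<bar>\<xi>$1\<bar>" "\<bar>2 * x * \<xi>$2\<bar> = 2 * x * \<bar>\<xi>$2\<bar>"
        using cx[OF x] x by (auto simp: abs_mult)
      ultimately have "\<bar>\<xi>$1\<bar> / 2 \<le> \<bar>(1 + 3 * c * x^2) * \<xi>$1 + 2 * x * \<xi>$2\<bar>" by linarith
      then have "2 * 3 * (\<bar>\<xi>$1\<bar> / 2) \<le> \<bar>f' x\<bar>"
        unfolding A using pw by (intro mult_mono) auto
      then show "R \<le> \<bar>f' x\<bar>" using R1 by linarith
      have B: "\<bar>f'' x\<bar> = 2 * (pi * w) * \<bar>6 * (c * x) * \<xi>$1 + 2 * \<xi>$2\<bar>"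
        using w by (simp add: f''_def abs_mult mult.assoc)
      have "\<bar>(c * x) * \<xi>$1\<bar> \<le> 1/4 * \<bar>\<xi>$1\<bar>"
        unfolding abs_mult[of "c * x"] using cx[OF x] by (intro mult_right_mono) auto
      then have "\<bar>6 * (c * x) * \<xi>$1 + 2 * \<xi>$2\<bar> \<le> 4 * \<bar>\<xi>$1\<bar>" using True by linarith
      then have "\<bar>f'' x\<bar> \<le> 2 * 8 * (4 * \<bar>\<xi>$1\<bar>)"
        unfolding B using pw by (intro mult_mono) auto
      also have "\<bar>\<xi>$1\<bar> \<le> R" unfolding R_def by (rule component_le_norm_cart)
      finally show "\<bar>f'' x\<bar> \<le> 64 * R" by simp
    qed (use e R in auto)
    also have "\<dots> = (2 + 64 * e) / R" using R by (simp add: power2_eq_square field_simps)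
    \<comment> \<open>Origin of the constant: \<open>2 + 64 * e \<le> 18\<close> for
      \<open>e \<le> 1/4\<close>.\<close>
    also have "\<dots> \<le> 18 / R" using e R by (intro divide_right_mono) auto
    also have "\<dots> \<le> 18 / sqrt R"
      using R real_sqrt_le_mono[of R "R\<^sup>2"] power_increasing[of 1 2 R] by (intro divide_left_mono) auto
    finally show ?thesis .
  next
    case False
    have R2: "R \<le> 3 * \<bar>\<xi>$2\<bar>" using R False small by simp
    \<comment> \<open>The cubic term takes away at most 3/2 of the main term
      \<open>2 * \<xi>$2\<close>, so \<open>|\<xi>$2| / 2\<close> is left and the sign is that of
      \<open>\<xi>$2\<close>.\<close>
    have P: "\<bar>6 * c * x * \<xi>$1\<bar> \<le> 3/2 * \<bar>\<xi>$2\<bar>" if x: "x \<in> {0..e}" for x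
    proof -
      have "\<bar>(c * x) * \<xi>$1\<bar> \<le> 1/4 * \<bar>\<xi>$2\<bar>"
        unfolding abs_mult[of "c * x"] using cx[OF x] False by (intro mult_mono) auto
      then show ?thesis by (simp add: mult.assoc)
    qed
    have pos: "R \<le> 2 * (pi * w) * z" if "\<bar>\<xi>$2\<bar> / 2 \<le> z" for z
    proof -
      have "2 * 3 * (\<bar>\<xi>$2\<bar> / 2) \<le> 2 * (pi * w) * z" using pw that by (intro mult_mono) auto
      then show ?thesis using R2 by linarith
    qed
    have "(\<forall>x\<in>{0..e}. R \<le> f'' x) \<or> (\<forall>x\<in>{0..e}. f'' x \<le> - R)"
    proof (cases "\<xi>$2 < 0")
      case True
      have "R \<le> f'' x" if "x \<in> {0..e}" for x
      proof -
        have "\<bar>\<xi>$2\<bar> / 2 \<le> - (6 * c * x * \<xi>$1 + 2 * \<xi>$2)" using P[OF that] True by linarith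
        from pos[OF this] show ?thesis by (simp add: f''_def mult.assoc algebra_simps)
      qed
      then show ?thesis by blast
    next
      case False
      have "f'' x \<le> - R" if "x \<in> {0..e}" for x
      proof -
        have "\<bar>\<xi>$2\<bar> / 2 \<le> 6 * c * x * \<xi>$1 + 2 * \<xi>$2" using P[OF that] False by linarith
        from pos[OF this] show ?thesis by (simp add: f''_def mult.assoc algebra_simps)
      qed
      then show ?thesis by blast
    qed
    then have "cmod (integral {0..e} (\<lambda>x. cis (f x))) \<le> 6 / sqrt R"
      using e R by (intro van_der_Corput_second[OF _ f f']) auto
    also have "\<dots> \<le> 18 / sqrt R" using R by (intro divide_right_mono) auto
    finally show ?thesis .
  qed
  then show ?thesis unfolding f_eq R_def .
qed

text \<open>The phase is affine in \<open>h\<close>. Since \<open>x \<le> 1/4\<close>, the first two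
  coordinates contribute at most half of \<open>|\<xi>$3|\<close> to the slope, so there is no
  stationary point and the first-derivative test applies with \<open>L = 0\<close>.\<close>

lemma surface_phase_integral_h:
  fixes \<xi> :: "real^3"
  assumes e: "e \<le> 1/4" and c: "0 \<le> c" "c \<le> 1" and d: "0 \<le> d" "d \<le> 1"
    and x: "0 \<le> x" "x \<le> e" and \<xi>: "norm \<xi> \<ge> 1" and large: "max \<bar>\<xi>$1\<bar> \<bar>\<xi>$2\<bar> \<le> \<bar>\<xi>$3\<bar>"
  shows "cmod (integral {1..2} (\<lambda>h. cis (- 2 * pi * (surface_point c d x h \<bullet> \<xi>)))) \<le> 2 / sqrt (norm \<xi>)"
proof -
  define R where "R = norm \<xi>"
  have "R \<le> \<bar>\<xi>$1\<bar> + \<bar>\<xi>$2\<bar> + \<bar>\<xi>$3\<bar>" using norm_le_l1_cart[of \<xi>] by (auto simp: R_def sum_3)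
  then have R: "R \<le> 3 * \<bar>\<xi>$3\<bar>" "1 \<le> R" using large \<xi> by (auto simp: R_def)
  define P where "P = (x + c * x^3) * \<xi>$1 + x^2 * \<xi>$2"
  define f where "f h = - 2 * pi * ((d * h + (1 - d)) * P + h * \<xi>$3)" for h
  have f: "(f has_real_derivative - 2 * pi * (d * P + \<xi>$3)) (at h)" for h
    unfolding f_def by (auto intro!: derivative_eq_intros simp: algebra_simps)
  have f_eq: "- 2 * pi * (surface_point c d x h \<bullet> \<xi>) = f h" for h
    by (simp add: f_def surface_point_def P_def inner_vec_def sum_3 algebra_simps)
  have "x^2 \<le> (1/4)^2" "x^3 \<le> (1/4)^3" using x e by (auto intro!: power_mono)
  then have x23: "x^2 \<le> 1/16" "x^3 \<le> 1/64" by (auto simp: power_divide)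
  then have "c * x^3 \<le> 1 * (1/64)" "0 \<le> c * x^3" using c x by (intro mult_mono mult_nonneg_nonneg; simp)+
  then have "\<bar>x + c * x^3\<bar> \<le> 3/8" using x e by linarith
  then have "\<bar>(x + c * x^3) * \<xi>$1\<bar> \<le> 3/8 * \<bar>\<xi>$3\<bar>"
    unfolding abs_mult[of "x + c * x^3"] using large by (intro mult_mono) auto
  moreover have "\<bar>x^2 * \<xi>$2\<bar> \<le> 1/8 * \<bar>\<xi>$3\<bar>"
    unfolding abs_mult[of "x^2"] using x23 large by (intro mult_mono) auto
  ultimately have "\<bar>P\<bar> \<le> \<bar>\<xi>$3\<bar> / 2" unfolding P_def by linarith
  then have "\<bar>d * P\<bar> \<le> 1 * (\<bar>\<xi>$3\<bar> / 2)" unfolding abs_mult using d by (intro mult_mono) auto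
  then have "\<bar>\<xi>$3\<bar> / 2 \<le> \<bar>d * P + \<xi>$3\<bar>" by linarith
  then have "2 * 3 * (\<bar>\<xi>$3\<bar> / 2) \<le> 2 * pi * \<bar>d * P + \<xi>$3\<bar>"
    using pi_gt3 by (intro mult_mono) auto
  also have "\<dots> = \<bar>- 2 * pi * (d * P + \<xi>$3)\<bar>" by (simp add: abs_mult)
  finally have f'_ge: "R \<le> \<bar>- 2 * pi * (d * P + \<xi>$3)\<bar>" using R by linarith
  have "cmod (integral {1..2} (\<lambda>h. cis (f h))) \<le> 2 / R + 0 * (2 - 1) / R\<^sup>2"
    by (rule van_der_Corput_first[OF _ f, of _ _ "\<lambda>_. 0"]) (use R f'_ge in auto)
  also have "\<dots> \<le> 2 / sqrt R"
    using R real_sqrt_le_mono[of R "R\<^sup>2"] power_increasing[of 1 2 R] by (auto intro!: divide_left_mono)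
  finally show ?thesis unfolding f_eq R_def .
qed

lemma norm_integral_le_const_bound:
  fixes F :: "'a \<Rightarrow> complex"
  assumes "finite_measure M" "integrable M F" "\<And>x. x \<in> space M \<Longrightarrow> cmod (F x) \<le> B"
  shows "cmod (integral\<^sup>L M F) \<le> B * measure M (space M)"
proof -
  interpret finite_measure M by fact
  have "cmod (integral\<^sup>L M F) \<le> (\<integral>x. cmod (F x) \<partial>M)" by (rule integral_norm_bound)
  also have "\<dots> \<le> (\<integral>x. B \<partial>M)" using assms by (intro integral_mono) auto
  finally show ?thesis by (simp add: mult.commute)
qed

text \<open>The measure is the push-forward of Lebesgue measure on
  \<open>{0..e} \<times> {1..2}\<close>; \<open>h \<ge> 1\<close> stays away from the apex of the
  cone. By Fubini the inner variable may be chosen according to the dominant component of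
  \<open>\<xi>\<close>.\<close>

lemma surface_measure_decay:
  assumes e: "0 < e" "e \<le> 1/4" and c: "0 \<le> c" "c \<le> 1" and d: "0 \<le> d" "d \<le> 1"
    and A: "\<And>x h. 0 \<le> x \<Longrightarrow> x \<le> e \<Longrightarrow> 1 \<le> h \<Longrightarrow> h \<le> 2 \<Longrightarrow> surface_point c d x h \<in> A"
  shows "\<exists>\<mu>\<in>meas_on A. \<exists>C. \<forall>\<xi>. norm \<xi> powr (1 / 2) * cmod (fourier_meas \<mu> \<xi>) \<le> C"
proof -
  define M1 where "M1 = restrict_space lborel {0..e}"
  define M2 where "M2 = restrict_space lborel {1..2::real}"
  have sp1: "space M1 = {0..e}" and sp2: "space M2 = {1..2}"
    by (auto simp: M1_def M2_def space_restrict_space)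
  have em1: "emeasure M1 {0..e} = ennreal e" and em2: "emeasure M2 {1..2} = 1"
    using e by (simp_all add: M1_def M2_def emeasure_restrict_space)
  interpret M1: finite_measure M1
    by (rule finite_measureI) (simp add: sp1 em1)
  interpret M2: finite_measure M2
    by (rule finite_measureI) (simp add: sp2 em2)
  interpret P: pair_sigma_finite M1 M2 ..
  interpret PP: finite_measure "M1 \<Otimes>\<^sub>M M2"
    by (rule finite_measure_pair_measure) unfold_locales
  have m1: "measure M1 (space M1) = e" and m2: "measure M2 (space M2) = 1"
    using e by (simp_all add: measure_def sp1 sp2 em1 em2)
  define \<Phi> where "\<Phi> = (\<lambda>(x, h). surface_point c d x h)"
  have cont: "continuous_on S \<Phi>" for S
    unfolding \<Phi>_def surface_point_def vector_3_eq split_def by (intro continuous_intros)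
  have meas[measurable]: "\<Phi> \<in> measurable (M1 \<Otimes>\<^sub>M M2) borel"
  proof -
    have "(\<lambda>x. x) \<in> measurable M1 borel" "(\<lambda>x. x) \<in> measurable M2 borel"
      unfolding M1_def M2_def by (auto intro!: measurable_restrict_space1)
    then have "(\<lambda>p. (fst p, snd p)) \<in> measurable (M1 \<Otimes>\<^sub>M M2) (borel \<Otimes>\<^sub>M borel)"
      by measurable
    moreover have "\<Phi> \<in> measurable (borel \<Otimes>\<^sub>M borel) borel"
      unfolding borel_prod by (intro borel_measurable_continuous_onI cont)
    ultimately show ?thesis using measurable_compose by fastforce
  qed
  define \<mu> where "\<mu> = distr (M1 \<Otimes>\<^sub>M M2) borel \<Phi>"
  have "emeasure \<mu> UNIV = emeasure (M1 \<Otimes>\<^sub>M M2) ({0..e} \<times> {1..2})"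
    unfolding \<mu>_def by (simp add: emeasure_distr space_pair_measure sp1 sp2)
  also have "\<dots> = ennreal e * 1"
    using sets.top[of M1] sets.top[of M2] by (simp add: M2.emeasure_pair_measure_Times sp1 sp2 em1 em2)
  finally have nz: "emeasure \<mu> UNIV \<noteq> 0" using e by simp
  \<comment> \<open>\<open>A\<close> is not assumed measurable. The compact image \<open>K\<close>
    is, and it carries the measure and lies in \<open>A\<close>.\<close>
  define K where "K = \<Phi> ` ({0..e} \<times> {1..2})"
  have "compact K" unfolding K_def by (intro compact_continuous_image cont compact_Times) auto
  then have "K \<in> sets borel" by (intro borel_closed compact_imp_closed)
  then have "AE p in \<mu>. p \<in> K"
    unfolding \<mu>_def by (subst AE_distr_iff) (auto simp: K_def space_pair_measure sp1 sp2 intro!: AE_I2)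
  moreover have "K \<subseteq> A" using A by (auto simp: K_def \<Phi>_def)
  ultimately have "AE p in \<mu>. p \<in> A" by (auto elim!: eventually_mono)
  moreover have "sets \<mu> = sets borel" "finite_measure \<mu>"
    using PP.finite_measure_distr[OF meas] by (auto simp: \<mu>_def)
  ultimately have "\<mu> \<in> meas_on A"
    using nz by (auto simp: meas_on_def)
  moreover have "norm \<xi> powr (1 / 2) * cmod (fourier_meas \<mu> \<xi>) \<le> 18" for \<xi>
  proof -
    define F where "F x h = cis (- 2 * pi * (surface_point c d x h \<bullet> \<xi>))" for x h
    have ft: "fourier_meas \<mu> \<xi> = (\<integral>(x, h). F x h \<partial>(M1 \<Otimes>\<^sub>M M2))"
      unfolding fourier_meas_def \<mu>_def
      by (subst integral_distr[OF meas])
         (auto simp: F_def \<Phi>_def split_def intro!: borel_measurable_continuous_onI continuous_intros)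
    have F_eq: "(\<lambda>(x, h). F x h) = (\<lambda>p. cis (- 2 * pi * (\<Phi> p \<bullet> \<xi>)))"
      by (auto simp: F_def \<Phi>_def)
    have int: "integrable (M1 \<Otimes>\<^sub>M M2) (\<lambda>(x, h). F x h)"
      unfolding F_eq
    proof (rule PP.integrable_const_bound[of _ 1])
      have "(\<lambda>p. cis (- 2 * pi * (p \<bullet> \<xi>))) \<in> borel_measurable borel"
        by (intro borel_measurable_continuous_onI continuous_intros)
      from measurable_compose[OF meas this]
      show "(\<lambda>p. cis (- 2 * pi * (\<Phi> p \<bullet> \<xi>))) \<in> borel_measurable (M1 \<Otimes>\<^sub>M M2)" .
    qed auto
    have int_h: "(\<integral>h. F x h \<partial>M2) = integral {1..2} (F x)" for x
      unfolding M2_def F_def surface_point_def vector_3_eq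
      by (intro lborel_interval_integral continuous_intros)
    have int_x: "(\<integral>x. F x h \<partial>M1) = integral {0..e} (\<lambda>x. F x h)" for h
      unfolding M1_def F_def surface_point_def vector_3_eq
      by (intro lborel_interval_integral continuous_intros)
    show ?thesis
    proof (cases "norm \<xi> \<ge> 1")
      case False
      \<comment> \<open>Low frequencies: the transform is bounded by the total mass
        \<open>e \<le> 1\<close>.\<close>
      have "cmod (fourier_meas \<mu> \<xi>) \<le> 1 * measure (M1 \<Otimes>\<^sub>M M2) (space (M1 \<Otimes>\<^sub>M M2))"
        unfolding ft by (rule norm_integral_le_const_bound[OF _ int]) (auto simp: F_def PP.finite_measure_axioms)
      also have "\<dots> = e"
        using M2.emeasure_pair_measure_Times[of "{0..e}" M1 "{1..2}"] e sets.top[of M1] sets.top[of M2]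
        by (simp add: measure_def space_pair_measure sp1 sp2 em1 em2)
      finally have "cmod (fourier_meas \<mu> \<xi>) \<le> 1" using e by simp
      moreover have "norm \<xi> powr (1 / 2) \<le> 1" using False by (intro powr_le1) auto
      ultimately have "norm \<xi> powr (1 / 2) * cmod (fourier_meas \<mu> \<xi>) \<le> 1 * 1" by (intro mult_mono) auto
      then show ?thesis by simp
    next
      case True
      have "cmod (fourier_meas \<mu> \<xi>) \<le> 18 / sqrt (norm \<xi>)"
      proof (cases "\<bar>\<xi>$3\<bar> \<le> max \<bar>\<xi>$1\<bar> \<bar>\<xi>$2\<bar>")
        case small: True
        have "fourier_meas \<mu> \<xi> = (\<integral>h. \<integral>x. F x h \<partial>M1 \<partial>M2)"
          unfolding ft by (rule P.integral_snd[OF int, symmetric])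
        also have "cmod \<dots> \<le> 18 / sqrt (norm \<xi>) * measure M2 (space M2)"
        proof (rule norm_integral_le_const_bound[OF M2.finite_measure_axioms P.integrable_snd[OF int]])
          show "cmod (\<integral>x. F x h \<partial>M1) \<le> 18 / sqrt (norm \<xi>)" if "h \<in> space M2" for h
            using that unfolding int_x unfolding F_def sp2
            by (intro surface_phase_integral_x e c d True small) auto
        qed
        finally show ?thesis by (simp add: m2)
      next
        case large: False
        have "fourier_meas \<mu> \<xi> = (\<integral>x. \<integral>h. F x h \<partial>M2 \<partial>M1)"
          unfolding ft by (rule P.integral_fst[OF int, symmetric])
        also have "cmod \<dots> \<le> 2 / sqrt (norm \<xi>) * measure M1 (space M1)"
        proof (rule norm_integral_le_const_bound[OF M1.finite_measure_axioms P.integrable_fst[OF int]])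
          show "cmod (\<integral>h. F x h \<partial>M2) \<le> 2 / sqrt (norm \<xi>)" if "x \<in> space M1" for x
            using that large unfolding int_h unfolding F_def sp1
            by (intro surface_phase_integral_h[OF e(2)] c d True) auto
        qed
        also have "\<dots> \<le> 18 / sqrt (norm \<xi>) * 1"
          unfolding m1 using e by (intro mult_mono divide_right_mono) auto
        finally show ?thesis by simp
      qed
      moreover have "sqrt (norm \<xi>) > 0" using True by auto
      ultimately have "sqrt (norm \<xi>) * cmod (fourier_meas \<mu> \<xi>) \<le> 18"
        by (simp add: pos_le_divide_eq mult.commute)
      then show ?thesis by (simp add: powr_half_sqrt)
    qed
  qed
  ultimately show ?thesis by blast
qed

section \<open>Fourier dimension of the three surfaces\<close>

lemma fourier_dim_eq_1:
  fixes A :: "'a::euclidean_space set"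
  assumes "\<exists>\<mu>\<in>meas_on A. \<exists>C. \<forall>\<xi>. norm \<xi> powr (1 / 2) * cmod (fourier_meas \<mu> \<xi>) \<le> C"
    and "\<And>\<mu> s C. \<mu> \<in> meas_on A \<Longrightarrow>
      (\<And>\<xi>. norm \<xi> powr (s / 2) * cmod (fourier_meas \<mu> \<xi>) \<le> C) \<Longrightarrow> s \<le> 1"
  shows "fourier_dim A = 1"
  unfolding fourier_dim_def
proof (rule cSup_eq_maximum)
  have "real DIM('a) \<ge> 1" using DIM_positive[where 'a='a] by linarith
  then show "1 \<in> {s. 0 \<le> s \<and> s \<le> real DIM('a) \<and>
      (\<exists>\<mu>\<in>meas_on A. \<exists>C. \<forall>\<xi>. norm \<xi> powr (s / 2) * cmod (fourier_meas \<mu> \<xi>) \<le> C)}"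
    using assms(1) by simp
qed (use assms(2) in blast)

text \<open>The lower bound uses only a one-sided interval \<open>{0..e}\<close> inside
  \<open>I\<close>, and the upper bound holds for every \<open>I\<close>. This gives uniformity over
  all small intervals around 0.\<close>

lemma fourier_dim_cubic_cone:
  assumes c: "0 \<le> c" "c \<le> 1" and e: "0 < e" "e \<le> 1/4" "{0..e} \<subseteq> I"
  shows "fourier_dim {h *\<^sub>R vector [x + c * x^3, x^2, 1] :: real^3 | x h. x \<in> I} = 1"
proof (rule fourier_dim_eq_1)
  have "surface_point c 1 x h \<in> {h *\<^sub>R vector [x + c * x^3, x^2, 1] | x h. x \<in> I}"
    if "0 \<le> x" "x \<le> e" for x h
  proof -
    have "surface_point c 1 x h = h *\<^sub>R vector [x + c * x^3, x^2, 1]"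
      by (simp add: surface_point_def vec_eq_iff forall_3)
    moreover have "x \<in> I" using that e(3) by auto
    ultimately show ?thesis by blast
  qed
  then show "\<exists>\<mu>\<in>meas_on {h *\<^sub>R vector [x + c * x^3, x^2, 1] | x h. x \<in> I}.
      \<exists>C. \<forall>\<xi>::real^3. norm \<xi> powr (1 / 2) * cmod (fourier_meas \<mu> \<xi>) \<le> C"
    by (intro surface_measure_decay[OF e(1,2) c, of 1]) auto
qed (rule cubic_cone_decay_exponent_le_1[OF _ _ c])

lemma fourier_dim_parabolic_cylinder: "fourier_dim parabolic_cylinder = 1"
proof (rule fourier_dim_eq_1)
  have "surface_point 0 0 x h \<in> parabolic_cylinder" for x h
    by (auto simp: surface_point_def parabolic_cylinder_def)
  then show "\<exists>\<mu>\<in>meas_on parabolic_cylinder.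
      \<exists>C. \<forall>\<xi>. norm \<xi> powr (1 / 2) * cmod (fourier_meas \<mu> \<xi>) \<le> C"
    by (intro surface_measure_decay[of "1/4" 0 0]) auto
qed (rule parabolic_cylinder_decay_exponent_le_1)

theorem mainTheorem7:
  shows "fourier_dim parabolic_cone = 1
    \<and> (\<exists>a b. a < 0 \<and> 0 < b \<and>
         (\<forall>a' b'. a \<le> a' \<and> a' < 0 \<and> 0 < b' \<and> b' \<le> b \<longrightarrow>
            fourier_dim (perturbed_cone {a'<..<b'}) = 1))
    \<and> fourier_dim parabolic_cylinder = 1"
proof (intro conjI)
  show "fourier_dim parabolic_cone = 1"
    using fourier_dim_cubic_cone[of 0 "1/4" UNIV] by (simp add: parabolic_cone_def)
  \<comment> \<open>\<open>e = b' / 4\<close> stays inside the open interval, and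
    \<open>b' \<le> 1\<close> ensures \<open>e \<le> 1/4\<close>. Hence the witness 1 for
    \<open>b\<close>; on the left only \<open>a' < 0\<close> matters.\<close>
  have "fourier_dim (perturbed_cone {a'<..<b'}) = 1" if "a' < 0" "0 < b'" "b' \<le> 1" for a' b'
  proof -
    have "{0..b' / 4} \<subseteq> {a'<..<b'}" using that by auto
    then show ?thesis
      using fourier_dim_cubic_cone[of 1 "b' / 4" "{a'<..<b'}"] that by (simp add: perturbed_cone_def)
  qed
  then show "\<exists>a b. a < 0 \<and> 0 < b \<and>
      (\<forall>a' b'. a \<le> a' \<and> a' < 0 \<and> 0 < b' \<and> b' \<le> b \<longrightarrow>
        fourier_dim (perturbed_cone {a'<..<b'}) = 1)"
    by (intro exI[of _ "-1"] exI[of _ 1]) auto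
  show "fourier_dim parabolic_cylinder = 1" by (rule fourier_dim_parabolic_cylinder)
qed

end
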